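(* Let $n$ and $r$ be positive integers with $1 \le r < n$. Then the complement graph $C(2n,r)^c$ is non-singular if and only if all of the following conditions hold: 1. $n$ and $r$ have the same parity; 2. $\gcd(n, r+1) = 1$; and 3. the highest power of $2$ dividing $n$ is strictly smaller than the highest power of $2$ dividing $n-r$.
   Context: A graph is called non-singular if its adjacency matrix is non-singular. The complement $X^c$ of a graph $X$ has the same vertex set, and two distinct vertices are adjacent in $X^c$ exactly when they are not adjacent in $X$ (no loops). For a positive integer $m\ge 3$, $C_m$ denotes the cycle graph on $m$ vertices. For $1 \le r < \lfloor m/2 \rfloor$, $C_m^{(r)}$ is the graph with the same vertex set as $C_m$ in which two distinct vertices are adjacent exactly when their distance in $C_m$ is at most $r$. The graph $C_{2n}^{n}$ is the graph on the vertex set of $C_{2n}$ in which two vertices are adjacent exactly when their distance in $C_{2n}$ equals $n$. For $1 \le r < n$, $C(2n,r)$ is the graph on $2n$ vertices whose adjacency matrix is the sum of the adjacency matrices of $C_{2n}^{(r)}$ and $C_{2n}^{n}$. *)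

theory Defs
  imports
    "Graph_Theory.Graph_Theory"
    "Jordan_Normal_Form.Matrix"
    "HOL-Computational_Algebra.Primes"
begin

text \<open>Undirected simple graphs are represented as symmetric, loop-free digraphs given by a
  vertex set and a set of ordered pairs (compare the locale \<^locale>\<open>pair_graph\<close>).
  The vertex set of every graph on \<open>m\<close> vertices below is \<open>{0..<m}\<close>.\<close>

definition complement_graph :: "'a pair_pre_digraph \<Rightarrow> 'a pair_pre_digraph" where
  "complement_graph G =
     \<lparr> pverts = pverts G,
       parcs = {(u, v). u \<in> pverts G \<and> v \<in> pverts G \<and> u \<noteq> v \<and> (u, v) \<notin> parcs G} \<rparr>"

text \<open>The distance is the least length of a walk (\<open>\<infinity>\<close> if there is none): every arc has weight 1.\<close>

definition graph_dist :: "'a pair_pre_digraph \<Rightarrow> 'a \<Rightarrow> 'a \<Rightarrow> ereal" where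
  "graph_dist G = wf_digraph.\<mu> (with_proj G) (\<lambda>_. 1)"

text \<open>The adjacency matrix is only meaningful for graphs with vertex set \<open>{0..<card (pverts G)}\<close>,
  as then the vertices are the row and column indices.\<close>

definition adj_mat :: "nat pair_pre_digraph \<Rightarrow> real mat" where
  "adj_mat G = mat (card (pverts G)) (card (pverts G)) (\<lambda>(u, v). if (u, v) \<in> parcs G then 1 else 0)"

definition nonsingular_graph :: "nat pair_pre_digraph \<Rightarrow> bool" where
  "nonsingular_graph G \<longleftrightarrow> invertible_mat (adj_mat G)"

definition cycle_graph :: "nat \<Rightarrow> nat pair_pre_digraph" where
  "cycle_graph m =
     \<lparr> pverts = {0..<m},
       parcs = {(u, v). u < m \<and> v < m \<and> (v = (u + 1) mod m \<or> u = (v + 1) mod m)} \<rparr>"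

text \<open>The graph written \<open>C\<^sub>m\<^sup>(\<^sup>r\<^sup>)\<close>; the range of interest is \<open>1 \<le> r < m div 2\<close>.\<close>

definition cycle_power :: "nat \<Rightarrow> nat \<Rightarrow> nat pair_pre_digraph" where
  "cycle_power m r =
     \<lparr> pverts = pverts (cycle_graph m),
       parcs = {(u, v). u \<in> pverts (cycle_graph m) \<and> v \<in> pverts (cycle_graph m) \<and> u \<noteq> v \<and>
                        graph_dist (cycle_graph m) u v \<le> ereal (real r)} \<rparr>"

text \<open>The graph written \<open>C\<^sub>2\<^sub>n\<^sup>n\<close>.\<close>

definition cycle_antipodal :: "nat \<Rightarrow> nat pair_pre_digraph" where
  "cycle_antipodal n =
     \<lparr> pverts = pverts (cycle_graph (2 * n)),
       parcs = {(u, v). u \<in> pverts (cycle_graph (2 * n)) \<and> v \<in> pverts (cycle_graph (2 * n)) \<and>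
                        graph_dist (cycle_graph (2 * n)) u v = ereal (real n)} \<rparr>"

text \<open>\<open>C(2n,r)\<close> is read off from the sum of the two adjacency matrices; lemma
  \<open>adj_mat_C2n\<close> below states that this sum really is its adjacency matrix.
  The first argument is \<open>n\<close>, half the number of vertices.\<close>

definition C2n :: "nat \<Rightarrow> nat \<Rightarrow> nat pair_pre_digraph" where
  "C2n n r =
     \<lparr> pverts = {0..<2 * n},
       parcs = {(u, v). u < 2 * n \<and> v < 2 * n \<and>
                  (adj_mat (cycle_power (2 * n) r) + adj_mat (cycle_antipodal n)) $$ (u, v) \<noteq> 0} \<rparr>"

lemma wf_digraph_cycle_graph: "wf_digraph (with_proj (cycle_graph m))"
  by unfold_locales (auto simp: cycle_graph_def)

lemma pair_graph_cycle_graph: "m \<ge> 3 \<Longrightarrow> pair_graph (cycle_graph m)"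
proof -
  assume m: "m \<ge> 3"
  have "parcs (cycle_graph m) \<subseteq> {0..<m} \<times> {0..<m}"
    by (auto simp: cycle_graph_def)
  then have "finite (parcs (cycle_graph m))"
    by (rule finite_subset) auto
  moreover have "(u + 1) mod m \<noteq> u" if "u < m" for u
    using m that by (cases "u + 1 = m") auto
  ultimately show ?thesis
    by unfold_locales
       (auto simp: cycle_graph_def symmetric_conv Bex_def dest: sym)
qed

lemma adj_mat_C2n:
  assumes "r < n"
  shows "adj_mat (C2n n r) = adj_mat (cycle_power (2 * n) r) + adj_mat (cycle_antipodal n)"
  using assms
  by (intro eq_matI)
     (auto simp: adj_mat_def C2n_def cycle_power_def cycle_antipodal_def cycle_graph_def)

end

theory Submission
  imports "Jordan_Normal_Form.Determinant" "HOL-Computational_Algebra.Polynomial" Defs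
begin

text \<open>The adjacency matrix of \<open>C(2n,r)\<^sup>c\<close> is circulant, with offsets
  \<open>{r+1, \<dots>, 2n-r-1} - {n}\<close>. A circulant matrix is invertible iff its offset sum \<open>\<lambda>(z)\<close> is nonzero at
  all \<open>2n\<close>-th roots of unity \<open>z\<close>: otherwise the real part of \<open>(z^k)\<close> lies in the kernel, and
  conversely the discrete Fourier transform of a kernel vector vanishes everywhere. Summing the
  geometric series gives, with \<open>e = z^n = \<plusminus>1\<close>,
  \<open>(z - 1) z^r \<lambda>(z) = - (z^(r+1) - e) (z^r + e)\<close>, so the question becomes which of the systems
  \<open>z^n = z^(r+1) = \<plusminus>1\<close> and \<open>z^n = - z^r = \<plusminus>1\<close> have a solution \<open>z \<noteq> 1\<close>. The first, with sign \<open>+\<close>,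
  has one iff \<open>gcd n (r+1) > 1\<close>; the second has one iff the 2-adic valuations of \<open>n\<close> and \<open>r\<close>
  differ; and if these agree, \<open>z^n = z^(r+1) = -1\<close> is impossible, because it forces
  \<open>n\<close> and \<open>r+1\<close> to have the same valuation.\<close>

section \<open>Distances in cycles\<close>

lemma mod_Suc_eq_if:
  fixes u m :: nat
  assumes "u < m"
  shows "(u + 1) mod m = (if u + 1 = m then 0 else u + 1)"
  using assms by auto

lemma (in wf_digraph) awalk_cost_one: "awalk_cost (\<lambda>_. 1) p = real (length p)"
  by (induction p) auto

text \<open>The left side is the cyclic distance from \<open>u\<close> to \<open>v\<close>. Each arc
  changes it by at most one, so induction along the walk gives the bound.\<close>

lemma cycle_graph_awalk_length_ge:
  assumes "pre_digraph.awalk (with_proj (cycle_graph m)) u p v" "u < m"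
  shows "min \<bar>int u - int v\<bar> (int m - \<bar>int u - int v\<bar>) \<le> int (length p)"
proof -
  interpret wf_digraph "with_proj (cycle_graph m)" by (rule wf_digraph_cycle_graph)
  show ?thesis
    using assms
  proof (induction p arbitrary: u)
    case Nil
    then show ?case by (auto simp: awalk_Nil_iff)
  next
    case (Cons e p)
    obtain w where e: "e = (u, w)" "(u, w) \<in> parcs (cycle_graph m)"
      and walk: "awalk w p v"
      using Cons.prems by (cases e) (auto simp: awalk_Cons_iff)
    have w: "w < m" "w = (u + 1) mod m \<or> u = (w + 1) mod m"
      using e by (auto simp: cycle_graph_def)
    have v: "v < m"
      using awalk_last_in_verts[OF walk] by (simp add: cycle_graph_def)
    have "min \<bar>int w - int v\<bar> (int m - \<bar>int w - int v\<bar>) \<le> int (length p)"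
      using Cons.IH[OF walk] w by simp
    then show ?case
      \<comment> \<open>Splitting on the wrap-around at \<open>m\<close> removes \<open>mod\<close>
        and leaves linear arithmetic.\<close>
      using w v Cons.prems(2) mod_Suc_eq_if[of u m] mod_Suc_eq_if[of w m]
      by (auto split: if_splits)
  qed
qed

text \<open>With its backward counterpart, this realizes both ways round the cycle by explicit
  walks, which bound the distance from above.\<close>

lemma cycle_graph_awalk_forward:
  assumes "u < m"
  shows "\<exists>p. pre_digraph.awalk (with_proj (cycle_graph m)) u p ((u + d) mod m) \<and> length p = d"
proof -
  interpret wf_digraph "with_proj (cycle_graph m)" by (rule wf_digraph_cycle_graph)
  show ?thesis
  proof (induction d)
    case 0
    have "awalk u [] u"
      using assms by (simp add: awalk_Nil_iff) (simp add: cycle_graph_def)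
    then show ?case using assms by auto
  next
    case (Suc d)
    then obtain p where p: "awalk u p ((u + d) mod m)" "length p = d" by auto
    let ?e = "((u + d) mod m, (u + Suc d) mod m)"
    have "?e \<in> parcs (cycle_graph m)" "(u + Suc d) mod m \<in> pverts (cycle_graph m)"
      using assms by (auto simp: cycle_graph_def mod_Suc_eq)
    then have "awalk ((u + d) mod m) [?e] ((u + Suc d) mod m)"
      by (simp add: awalk_Cons_iff awalk_Nil_iff)
    from awalk_appendI[OF p(1) this] show ?case
      using p(2) by (intro exI[of _ "p @ [?e]"]) auto
  qed
qed

lemma cycle_graph_awalk_backward:
  assumes "u < m"
  shows "\<exists>p. pre_digraph.awalk (with_proj (cycle_graph m)) ((u + d) mod m) p u \<and> length p = d"
proof -
  interpret wf_digraph "with_proj (cycle_graph m)" by (rule wf_digraph_cycle_graph)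
  show ?thesis
  proof (induction d)
    case 0
    have "awalk u [] u"
      using assms by (simp add: awalk_Nil_iff) (simp add: cycle_graph_def)
    then show ?case using assms by auto
  next
    case (Suc d)
    then obtain p where p: "awalk ((u + d) mod m) p u" "length p = d" by auto
    let ?e = "((u + Suc d) mod m, (u + d) mod m)"
    have "?e \<in> parcs (cycle_graph m)"
      using assms by (auto simp: cycle_graph_def mod_Suc_eq)
    then have "awalk ((u + Suc d) mod m) (?e # p) u"
      using p(1) by (simp add: awalk_Cons_iff)
    then show ?case
      using p(2) by (intro exI[of _ "?e # p"]) auto
  qed
qed

lemma graph_dist_cycle_graph:
  assumes "u < m" "v < m"
  shows "graph_dist (cycle_graph m) u v =
    ereal (real_of_int (min \<bar>int u - int v\<bar> (int m - \<bar>int u - int v\<bar>)))"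
    (is "_ = ereal (real_of_int ?\<delta>)")
proof -
  interpret wf_digraph "with_proj (cycle_graph m)" by (rule wf_digraph_cycle_graph)
  have up: "\<mu> (\<lambda>_. 1) u v \<le> ereal (real d)" if "\<exists>p. awalk u p v \<and> length p = d" for d
    using that min_cost_le_walk_cost[of u _ v "\<lambda>_. 1"] by (auto simp: awalk_cost_one)
  have "\<exists>d. int d = ?\<delta> \<and> (\<exists>p. awalk u p v \<and> length p = d)"
  proof (cases "u \<le> v")
    case True
    \<comment> \<open>The two ways round. For \<open>u = v\<close> they are the empty walk and one
      full turn.\<close>
    have "(u + (v - u)) mod m = v" "(v + (m - (v - u))) mod m = u"
      using True assms by (auto simp: mod_if)
    then have "\<exists>p. awalk u p v \<and> length p = v - u" "\<exists>p. awalk u p v \<and> length p = m - (v - u)"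
      using cycle_graph_awalk_forward[OF assms(1), of "v - u"]
        cycle_graph_awalk_backward[OF assms(2), of "m - (v - u)"] by auto
    moreover have "?\<delta> = int (v - u) \<or> ?\<delta> = int (m - (v - u))"
      using True assms by auto
    ultimately show ?thesis by metis
  next
    case False
    have "(v + (u - v)) mod m = u" "(u + (m - (u - v))) mod m = v"
      using False assms by (auto simp: mod_if)
    then have "\<exists>p. awalk u p v \<and> length p = u - v" "\<exists>p. awalk u p v \<and> length p = m - (u - v)"
      using cycle_graph_awalk_backward[OF assms(2), of "u - v"]
        cycle_graph_awalk_forward[OF assms(1), of "m - (u - v)"] by auto
    moreover have "?\<delta> = int (u - v) \<or> ?\<delta> = int (m - (u - v))"
      using False assms by auto
    ultimately show ?thesis by metis
  qed
  then obtain d where d: "int d = ?\<delta>" "\<exists>p. awalk u p v \<and> length p = d" by blast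
  have "real_of_int ?\<delta> = real d"
    using d(1) by (metis of_int_of_nat_eq)
  then have "\<mu> (\<lambda>_. 1) u v \<le> ereal (real_of_int ?\<delta>)"
    using up[OF d(2)] by metis
  moreover have "ereal (real_of_int ?\<delta>) \<le> \<mu> (\<lambda>_. 1) u v"
    unfolding \<mu>_def
  proof (rule INF_greatest)
    fix p assume "p \<in> {p. awalk u p v}"
    then have "?\<delta> \<le> int (length p)"
      using cycle_graph_awalk_length_ge assms(1) by blast
    then have "real_of_int ?\<delta> \<le> real (length p)"
      by (metis of_int_le_iff of_int_of_nat_eq)
    then show "ereal (real_of_int ?\<delta>) \<le> ereal (awalk_cost (\<lambda>_. 1) p)"
      by (simp only: awalk_cost_one ereal_less_eq)
  qed
  ultimately show ?thesis
    unfolding graph_dist_def by (rule antisym)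
qed

text \<open>The entry depends only on the offset \<open>v - u\<close> modulo \<open>2 * n\<close>;
  adding \<open>2 * n\<close> first avoids truncated subtraction. Offsets strictly between
  \<open>r\<close> and \<open>2 * n - r\<close> mean cyclic distance above \<open>r\<close>, and
  offset \<open>n\<close> is the antipode.\<close>

lemma adj_mat_complement_C2n:
  assumes "r < n" "u < 2 * n" "v < 2 * n"
  shows "adj_mat (complement_graph (C2n n r)) $$ (u, v) =
    of_bool ((v + 2 * n - u) mod (2 * n) \<in> {r<..<2 * n - r} - {n})"
proof -
  let ?\<delta> = "min \<bar>int u - int v\<bar> (int (2 * n) - \<bar>int u - int v\<bar>)"
  note dist = graph_dist_cycle_graph[OF assms(2,3)]
  \<comment> \<open>Moving from \<open>ereal\<close> to \<open>int\<close> makes the later case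
    split linear arithmetic.\<close>
  have le: "graph_dist (cycle_graph (2 * n)) u v \<le> ereal (real r) \<longleftrightarrow> ?\<delta> \<le> int r"
    unfolding dist ereal_less_eq by (metis of_int_le_iff of_int_of_nat_eq)
  have eq: "graph_dist (cycle_graph (2 * n)) u v = ereal (real n) \<longleftrightarrow> ?\<delta> = int n"
    unfolding dist ereal.inject by (metis of_int_eq_iff of_int_of_nat_eq)
  have "(u, v) \<in> parcs (complement_graph (C2n n r)) \<longleftrightarrow>
      u \<noteq> v \<and> \<not> (?\<delta> \<le> int r) \<and> ?\<delta> \<noteq> int n"
    using assms le eq
    by (simp add: complement_graph_def C2n_def adj_mat_def cycle_power_def cycle_antipodal_def
        cycle_graph_def del: min_less_iff_conj)
  also have "\<dots> \<longleftrightarrow> (v + 2 * n - u) mod (2 * n) \<in> {r<..<2 * n - r} - {n}"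
  proof (cases "u \<le> v")
    case True
    then have "(v + 2 * n - u) mod (2 * n) = v - u"
      using assms by (simp add: mod_if)
    then show ?thesis using True assms by auto
  next
    case False
    then have "(v + 2 * n - u) mod (2 * n) = v + 2 * n - u"
      using assms by simp
    then show ?thesis using False assms by auto
  qed
  finally show ?thesis
    using assms by (simp add: adj_mat_def complement_graph_def C2n_def)
qed

section \<open>Circulant matrices\<close>

lemma invertible_mat_iff_kernel_trivial:
  fixes A :: "'a :: field mat"
  assumes A: "A \<in> carrier_mat m m"
  shows "invertible_mat A \<longleftrightarrow> (\<forall>x \<in> carrier_vec m. A *\<^sub>v x = 0\<^sub>v m \<longrightarrow> x = 0\<^sub>v m)"
proof
  assume "invertible_mat A"
  then obtain B where B: "inverts_mat A B" "inverts_mat B A"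
    by (auto simp: invertible_mat_def)
  have AB: "A * B = 1\<^sub>m m"
    using B(1) A by (auto simp: inverts_mat_def)
  have BA: "B * A = 1\<^sub>m (dim_row B)"
    using B(2) by (auto simp: inverts_mat_def)
  \<comment> \<open>\<open>invertible_mat\<close> does not fix the shape of \<open>B\<close>; the
    dimensions of the two identity matrices do.\<close>
  have "dim_col (A * B) = m" "dim_col (B * A) = dim_row B"
    using AB BA by auto
  then have Bc: "B \<in> carrier_mat m m"
    using A by auto
  show "\<forall>x \<in> carrier_vec m. A *\<^sub>v x = 0\<^sub>v m \<longrightarrow> x = 0\<^sub>v m"
  proof (intro ballI impI)
    fix x assume x: "x \<in> carrier_vec m" "A *\<^sub>v x = 0\<^sub>v m"
    have "x = (B * A) *\<^sub>v x"
      using BA Bc x by simp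
    also have "\<dots> = B *\<^sub>v (A *\<^sub>v x)"
      using A Bc x by (intro assoc_mult_mat_vec) auto
    also have "\<dots> = 0\<^sub>v m"
      using Bc x by auto
    finally show "x = 0\<^sub>v m" .
  qed
next
  assume "\<forall>x \<in> carrier_vec m. A *\<^sub>v x = 0\<^sub>v m \<longrightarrow> x = 0\<^sub>v m"
  then have "det A \<noteq> 0"
    using det_0_iff_vec_prod_zero[OF A] by blast
  from det_non_zero_imp_unit[OF A this, of "()"]
  obtain B where "B \<in> carrier_mat m m" "B * A = 1\<^sub>m m" "A * B = 1\<^sub>m m"
    unfolding Units_def ring_mat_def by auto
  then show "invertible_mat A"
    using A unfolding invertible_mat_def inverts_mat_def by auto
qed

lemma power_mod_eq:
  fixes z :: "'a :: monoid_mult"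
  assumes "z ^ m = 1"
  shows "z ^ (k mod m) = z ^ k"
proof -
  have "z ^ k = z ^ (m * (k div m) + k mod m)" by simp
  also have "\<dots> = z ^ (k mod m)"
    using assms by (simp only: power_add power_mult power_one mult_1_left)
  finally show ?thesis ..
qed

text \<open>The powers of \<open>z\<close> form an eigenvector whose eigenvalue is the offset sum:
  exponents matter only modulo \<open>m\<close>, so \<open>v\<close> can be replaced by
  \<open>u + d\<close>.\<close>

lemma circulant_row_sum:
  fixes z :: "'a :: comm_semiring_1"
  assumes z: "z ^ m = 1" and u: "u < m"
  shows "(\<Sum>v<m. f ((v + m - u) mod m) * z ^ v) = z ^ u * (\<Sum>d<m. f d * z ^ d)"
proof -
  have "(\<Sum>v<m. f ((v + m - u) mod m) * z ^ v) = (\<Sum>d<m. f d * z ^ ((u + d) mod m))"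
    using u
    by (intro sum.reindex_bij_witness[of _ "\<lambda>d. (u + d) mod m" "\<lambda>v. (v + m - u) mod m"])
      (auto simp: mod_if)
  also have "\<dots> = z ^ u * (\<Sum>d<m. f d * z ^ d)"
    unfolding power_mod_eq[OF z] by (simp add: sum_distrib_left power_add mult_ac)
  finally show ?thesis .
qed

text \<open>Here the substitution is \<open>u = v - d\<close>, so the offset sum appears at the
  inverse \<open>w\<close> of \<open>z\<close>.\<close>

lemma circulant_column_sum:
  fixes z w :: "'a :: comm_semiring_1"
  assumes z: "z ^ m = 1" and zw: "z * w = 1" and v: "v < m"
  shows "(\<Sum>u<m. f ((v + m - u) mod m) * z ^ u) = z ^ v * (\<Sum>d<m. f d * w ^ d)"
proof -
  have "(\<Sum>u<m. f ((v + m - u) mod m) * z ^ u) = (\<Sum>d<m. f d * z ^ ((v + m - d) mod m))"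
    using v
    by (intro sum.reindex_bij_witness[of _ "\<lambda>d. (v + m - d) mod m" "\<lambda>u. (v + m - u) mod m"])
      (auto simp: mod_if)
  also have "\<dots> = (\<Sum>d<m. f d * (z ^ v * w ^ d))"
  proof (intro sum.cong refl)
    fix d assume "d \<in> {..<m}"
    then have "z ^ (v + m - d) * z ^ d = z ^ v"
      using z by (simp flip: power_add) (simp add: power_add)
    \<comment> \<open>The factor \<open>(z * w) ^ d = 1\<close> turns the shift by \<open>-d\<close>
      into a power of \<open>w\<close>.\<close>
    then have "z ^ v * w ^ d = z ^ (v + m - d) * (z * w) ^ d"
      by (metis mult.assoc power_mult_distrib)
    then show "f d * z ^ ((v + m - d) mod m) = f d * (z ^ v * w ^ d)"
      using zw by (simp add: power_mod_eq[OF z])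
  qed
  also have "\<dots> = z ^ v * (\<Sum>d<m. f d * w ^ d)"
    by (simp add: sum_distrib_left mult_ac)
  finally show ?thesis .
qed

text \<open>The transform evaluates a polynomial of degree below \<open>m\<close> with coefficients
  \<open>x\<close>; vanishing at \<open>m\<close> distinct roots of unity makes it zero.\<close>

lemma discrete_fourier_eq_0_imp:
  fixes x :: "nat \<Rightarrow> complex"
  assumes "\<And>z. z ^ m = 1 \<Longrightarrow> (\<Sum>u<m. x u * z ^ u) = 0" and "v < m"
  shows "x v = 0"
proof -
  define p where "p = (\<Sum>u<m. monom (x u) u)"
  have poly: "poly p z = (\<Sum>u<m. x u * z ^ u)" for z
    by (simp add: p_def poly_sum poly_monom)
  have "degree p < m"
    unfolding p_def using assms(2)
    by (intro degree_sum_less) (auto intro: le_less_trans[OF degree_monom_le])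
  moreover have "card {z::complex. z ^ m = 1} = m"
    using assms(2) by (intro card_roots_unity_eq) auto
  ultimately have "p = 0"
    using assms by (intro poly_eqI_degree[of "{z. z ^ m = 1}"]) (auto simp: poly)
  moreover have "coeff p v = x v"
    using assms(2) by (simp add: p_def coeff_sum)
  ultimately show ?thesis by simp
qed

lemma invertible_circulant_iff:
  fixes A :: "real mat" and f :: "nat \<Rightarrow> real"
  assumes A: "A \<in> carrier_mat m m" and m: "m > 0"
    and f: "\<And>u v. u < m \<Longrightarrow> v < m \<Longrightarrow> A $$ (u, v) = f ((v + m - u) mod m)"
  shows "invertible_mat A \<longleftrightarrow>
    (\<forall>z::complex. z ^ m = 1 \<longrightarrow> (\<Sum>d<m. of_real (f d) * z ^ d) \<noteq> 0)"
proof
  assume inv: "invertible_mat A"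
  show "\<forall>z::complex. z ^ m = 1 \<longrightarrow> (\<Sum>d<m. of_real (f d) * z ^ d) \<noteq> 0"
  proof (intro allI impI notI)
    fix z :: complex
    assume z: "z ^ m = 1" and 0: "(\<Sum>d<m. of_real (f d) * z ^ d) = 0"
    \<comment> \<open>As \<open>f\<close> is real, taking real parts keeps the vector in the kernel;
      its entry at \<open>0\<close> is \<open>1\<close>, so it is nonzero.\<close>
    let ?x = "vec m (\<lambda>v. Re (z ^ v))"
    have "A *\<^sub>v ?x = 0\<^sub>v m"
    proof (rule eq_vecI)
      fix u assume "u < dim_vec (0\<^sub>v m :: real vec)"
      then have u: "u < m" by simp
      have "(A *\<^sub>v ?x) $ u = (\<Sum>v<m. f ((v + m - u) mod m) * Re (z ^ v))"
        using A u f by (auto simp: scalar_prod_def lessThan_atLeast0 intro!: sum.cong)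
      also have "\<dots> = Re (\<Sum>v<m. of_real (f ((v + m - u) mod m)) * z ^ v)"
        by simp
      also have "\<dots> = 0"
        unfolding circulant_row_sum[OF z u, of "\<lambda>d. of_real (f d)"] 0 by simp
      finally show "(A *\<^sub>v ?x) $ u = 0\<^sub>v m $ u" using u by simp
    qed (use A in auto)
    then have "?x = 0\<^sub>v m"
      using inv invertible_mat_iff_kernel_trivial[OF A] by auto
    then have "?x $ 0 = 0" using m by simp
    then show False using m by simp
  qed
next
  assume nz: "\<forall>z::complex. z ^ m = 1 \<longrightarrow> (\<Sum>d<m. of_real (f d) * z ^ d) \<noteq> 0"
  show "invertible_mat A"
    unfolding invertible_mat_iff_kernel_trivial[OF A]
  proof (intro ballI impI)
    fix x assume x: "x \<in> carrier_vec m" "A *\<^sub>v x = 0\<^sub>v m"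
    have row: "(\<Sum>v<m. f ((v + m - u) mod m) * x $ v) = 0" if u: "u < m" for u
    proof -
      have "(\<Sum>v<m. f ((v + m - u) mod m) * x $ v) = (A *\<^sub>v x) $ u"
        using A u f x(1) by (auto simp: scalar_prod_def lessThan_atLeast0 intro!: sum.cong)
      then show ?thesis using x u by simp
    qed
    have "(\<Sum>v<m. of_real (x $ v) * z ^ v) = 0" if z: "z ^ m = 1" for z :: complex
    proof -
      have "z \<noteq> 0" using z m by (auto simp: power_0_left)
      then have zw: "z * inverse z = 1" by simp
      have "inverse z ^ m = 1" using z by (simp add: power_inverse)
      then have nz': "(\<Sum>d<m. of_real (f d) * inverse z ^ d) \<noteq> 0" using nz by blast
      \<comment> \<open>Weighting the zero rows by \<open>z ^ u\<close> and swapping sums factors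
        out the transform of \<open>x\<close> at \<open>z\<close>, times the offset sum at
        \<open>inverse z\<close>.\<close>
      have "0 = (\<Sum>u<m. of_real (\<Sum>v<m. f ((v + m - u) mod m) * x $ v) * z ^ u)"
        using row by simp
      also have "\<dots> = (\<Sum>u<m. \<Sum>v<m. of_real (x $ v) * (of_real (f ((v + m - u) mod m)) * z ^ u))"
        by (simp add: sum_distrib_left sum_distrib_right mult_ac)
      also have "\<dots> = (\<Sum>v<m. of_real (x $ v) * (\<Sum>u<m. of_real (f ((v + m - u) mod m)) * z ^ u))"
        by (subst sum.swap) (simp add: sum_distrib_left)
      also have "\<dots> = (\<Sum>v<m. of_real (x $ v) * (z ^ v * (\<Sum>d<m. of_real (f d) * inverse z ^ d)))"
        by (intro sum.cong refl arg_cong2[where f = "(*)"]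
            circulant_column_sum[OF z zw, where f = "\<lambda>d. of_real (f d)"]) auto
      also have "\<dots> = (\<Sum>v<m. of_real (x $ v) * z ^ v) * (\<Sum>d<m. of_real (f d) * inverse z ^ d)"
        by (simp add: sum_distrib_right mult_ac)
      finally show ?thesis using nz' by simp
    qed
    then have "complex_of_real (x $ v) = 0" if "v < m" for v
      using discrete_fourier_eq_0_imp[of m "\<lambda>v. of_real (x $ v)" v] that by blast
    then show "x = 0\<^sub>v m"
      using x by (intro eq_vecI) auto
  qed
qed

section \<open>Roots of unity\<close>

lemma power_gcd_eq_1:
  fixes z :: "'a :: field"
  assumes "z ^ a = 1" "z ^ b = 1"
  shows "z ^ gcd a b = 1"
proof (cases "a = 0")
  case False
  \<comment> \<open>Bezout in a form without subtraction, so that no negative exponents arise; it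
    requires \<open>a\<close> nonzero.\<close>
  then obtain x y where "a * x = b * y + gcd a b"
    using bezout_nat by blast
  then have "z ^ (a * x) = z ^ (b * y) * z ^ gcd a b"
    by (simp flip: power_add)
  then show ?thesis
    using assms by (simp add: power_mult)
qed (use assms in auto)

text \<open>Otherwise \<open>b * a' = a * c\<close> with \<open>a'\<close> the odd part of
  \<open>a\<close>, and raising \<open>z\<close> to this exponent gives both \<open>-1\<close> and
  \<open>1\<close>.\<close>

lemma multiplicity_2_less_of_powers:
  fixes z :: "'a :: field_char_0"
  assumes "z ^ a = 1" "z ^ b = -1" "a > 0"
  shows "multiplicity 2 b < multiplicity 2 a"
proof (rule ccontr)
  assume "\<not> ?thesis"
  then have "2 ^ multiplicity 2 a dvd b"
    by (intro multiplicity_dvd') auto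
  then obtain c where c: "b = 2 ^ multiplicity 2 a * c" ..
  obtain a' where a': "a = 2 ^ multiplicity 2 a * a'" "odd a'"
    using multiplicity_decompose'[of a 2] assms(3) by auto
  have "b * a' = a * c"
    using a'(1) c by (metis mult.assoc mult.commute)
  then have "(z ^ b) ^ a' = (z ^ a) ^ c"
    by (simp flip: power_mult)
  then show False
    using assms a' by simp
qed

text \<open>The power equals \<open>(-1) ^ c\<close> with \<open>a = 2 ^ k * c\<close>, and
  \<open>c\<close> is odd exactly when \<open>k\<close> is the full valuation of
  \<open>a\<close>.\<close>

lemma cis_power_two_adic:
  assumes "a > 0" "k \<le> multiplicity 2 a"
  shows "cis (pi / 2 ^ k) ^ a = (if k = multiplicity 2 a then - 1 else 1)"
proof -
  have "2 ^ k dvd a" using assms by (intro multiplicity_dvd')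
  then obtain c where c: "a = 2 ^ k * c" ..
  have "cis (pi / 2 ^ k) ^ a = cis pi ^ c"
    unfolding c power_mult by (simp add: Complex.DeMoivre)
  moreover have "odd c \<longleftrightarrow> k = multiplicity 2 a"
  proof -
    have "multiplicity 2 a = k + multiplicity 2 c"
      using assms(1) c by (simp add: prime_elem_multiplicity_mult_distrib)
    moreover have "even c \<longleftrightarrow> multiplicity 2 c \<noteq> 0"
      using assms(1) c by (simp add: multiplicity_eq_zero_iff)
    ultimately show ?thesis by auto
  qed
  ultimately show ?thesis by (auto simp: cis_pi)
qed

section \<open>Zeros of the offset sum\<close>

lemma offset_sum_times:
  fixes z :: "'a :: comm_ring_1"
  assumes "r < n" "z ^ (2 * n) = 1"
  shows "(z - 1) * z ^ r * (\<Sum>d\<in>{r<..<2 * n - r} - {n}. z ^ d) =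
    1 - z ^ (2 * r + 1) - z ^ n * (z ^ (r + 1) - z ^ r)"
proof -
  \<comment> \<open>The sum over the full interval telescopes; the term at \<open>n\<close> is
    subtracted later.\<close>
  have "(z - 1) * (\<Sum>d\<in>{Suc r..<2 * n - r}. z ^ d) =
      (\<Sum>d\<in>{Suc r..<2 * n - r}. z ^ Suc d - z ^ d)"
    by (simp add: sum_distrib_left algebra_simps)
  also have "\<dots> = z ^ (2 * n - r) - z ^ Suc r"
    using assms by (intro sum_Suc_diff') auto
  also have "{Suc r..<2 * n - r} = {r<..<2 * n - r}" by auto
  finally have geo: "(z - 1) * (\<Sum>d\<in>{r<..<2 * n - r}. z ^ d) = z ^ (2 * n - r) - z ^ Suc r" .
  \<comment> \<open>This is the purpose of the factor \<open>z ^ r\<close>: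
    \<open>z ^ (2 * n - r)\<close> is the inverse of \<open>z ^ r\<close>.\<close>
  have inv: "z ^ r * z ^ (2 * n - r) = 1"
    using assms by (simp flip: power_add)
  have diff: "(\<Sum>d\<in>{r<..<2 * n - r} - {n}. z ^ d) = (\<Sum>d\<in>{r<..<2 * n - r}. z ^ d) - z ^ n"
    using assms by (subst sum_diff1) auto
  have pow: "z ^ (2 * r + 1) = z ^ r * z ^ Suc r"
    by (simp only: mult_2 power_add power_one_right power_Suc) (simp only: mult_ac)
  have "(z - 1) * z ^ r * (x - y) = z ^ r * ((z - 1) * x) - y * (z ^ (r + 1) - z ^ r)" for x y
    by (simp add: algebra_simps)
  then show ?thesis
    unfolding diff pow by (simp only: geo right_diff_distrib[of "z ^ r"] inv)
qed

lemma offset_sum_eq_0_iff: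
  fixes z :: "'a :: field"
  assumes "r < n" "z \<noteq> 1" "z ^ (2 * n) = 1"
  shows "(\<Sum>d\<in>{r<..<2 * n - r} - {n}. z ^ d) = 0 \<longleftrightarrow>
    z ^ n = 1 \<and> (z ^ (r + 1) = 1 \<or> z ^ r = -1) \<or> z ^ n = -1 \<and> (z ^ (r + 1) = -1 \<or> z ^ r = 1)"
proof -
  have "z \<noteq> 0"
    using assms by (auto simp: power_0_left)
  have "(z ^ n)\<^sup>2 = 1"
    using assms(3) by (simp add: mult.commute flip: power_mult)
  then have n: "z ^ n = 1 \<or> z ^ n = -1"
    by (simp add: power2_eq_1_iff)
  have "(\<Sum>d\<in>{r<..<2 * n - r} - {n}. z ^ d) = 0 \<longleftrightarrow>
      1 - z ^ (2 * r + 1) - z ^ n * (z ^ (r + 1) - z ^ r) = 0"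
    unfolding offset_sum_times[OF assms(1,3), symmetric] using \<open>z \<noteq> 0\<close> assms(2) by simp
  also have "1 - z ^ (2 * r + 1) - z ^ n * (z ^ (r + 1) - z ^ r) =
      - ((z ^ (r + 1) - z ^ n) * (z ^ r + z ^ n))"
  proof -
    have pow: "z ^ (2 * r + 1) = z ^ (r + 1) * z ^ r"
      by (simp only: mult_2 power_add power_one_right) (simp only: mult_ac)
    have "z ^ n * z ^ n = 1"
      using \<open>(z ^ n)\<^sup>2 = 1\<close> by (simp add: power2_eq_square)
    \<comment> \<open>Applied with \<open>e = z ^ n\<close>, \<open>a = z ^ (r + 1)\<close>,
      \<open>b = z ^ r\<close>; reading \<open>1\<close> as \<open>e * e\<close> makes the
      expression factor.\<close>
    moreover have "e * e - a * b - e * (a - b) = - ((a - e) * (b + e))" for a b e :: 'a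
      by (simp add: algebra_simps)
    ultimately show ?thesis
      unfolding pow by metis
  qed
  also have "\<dots> = 0 \<longleftrightarrow> z ^ (r + 1) = z ^ n \<or> z ^ r = - (z ^ n)"
    by (simp add: eq_neg_iff_add_eq_0)
  finally show ?thesis using n by auto
qed

text \<open>If a condition on the right fails, an explicit root of unity is a zero. Conversely each
  of the four kinds of zero \<open>z \<noteq> 1\<close> contradicts a condition, and
  \<open>z = 1\<close> is treated by counting.\<close>

lemma offset_sum_nonzero_iff:
  assumes "1 \<le> r" "r < n"
  shows "(\<forall>z::complex. z ^ (2 * n) = 1 \<longrightarrow> (\<Sum>d\<in>{r<..<2 * n - r} - {n}. z ^ d) \<noteq> 0) \<longleftrightarrow>
    gcd n (r + 1) = 1 \<and> multiplicity 2 n = multiplicity 2 r"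
    (is "?L \<longleftrightarrow> ?R")
proof
  assume nz: ?L
  have "gcd n (r + 1) = 1"
  proof (rule ccontr)
    assume g: "gcd n (r + 1) \<noteq> 1"
    define g where "g = gcd n (r + 1)"
    have "g \<noteq> 0" using assms unfolding g_def by simp
    then have "g > 1" using g unfolding g_def by linarith
    have "card {z::complex. z ^ g = 1} > card {1::complex}"
      using \<open>g > 1\<close> by (simp add: card_roots_unity_eq)
    then have "{z::complex. z ^ g = 1} \<noteq> {1}" by fastforce
    then obtain z :: complex where z: "z ^ g = 1" "z \<noteq> 1" by fastforce
    have dvd: "z ^ k = 1" if "g dvd k" for k
      using that z(1) by (auto simp: power_mult)
    have "z ^ n = 1" "z ^ (r + 1) = 1" "z ^ (2 * n) = 1"
      by (intro dvd; simp add: g_def)+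
    then show False
      using offset_sum_eq_0_iff[OF assms(2) z(2)] nz by blast
  qed
  moreover have "multiplicity 2 n = multiplicity 2 r"
  proof (rule ccontr)
    assume ne: "multiplicity 2 n \<noteq> multiplicity 2 r"
    \<comment> \<open>Exactly one of the two valuations equals the minimum, so \<open>?z ^ n\<close>
      and \<open>?z ^ r\<close> have opposite signs.\<close>
    define k where "k = min (multiplicity 2 n) (multiplicity 2 r)"
    let ?z = "cis (pi / 2 ^ k)"
    have "?z ^ n = (if k = multiplicity 2 n then - 1 else 1)"
      "?z ^ r = (if k = multiplicity 2 r then - 1 else 1)"
      using assms by (intro cis_power_two_adic; simp add: k_def)+
    then have *: "?z ^ n = 1 \<and> ?z ^ r = -1 \<or> ?z ^ n = -1 \<and> ?z ^ r = 1"
      using ne by (auto simp: k_def min_def split: if_splits)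
    then have "?z \<noteq> 1" by auto
    moreover have "?z ^ (2 * n) = 1"
      using * by (auto simp: mult.commute[of 2] power_mult)
    ultimately show False
      using offset_sum_eq_0_iff[OF assms(2), of ?z] nz * by blast
  qed
  ultimately show ?R by simp
next
  assume R: ?R
  show ?L
  proof (intro allI impI notI)
    fix z :: complex
    assume z: "z ^ (2 * n) = 1" and 0: "(\<Sum>d\<in>{r<..<2 * n - r} - {n}. z ^ d) = 0"
    show False
    proof (cases "z = 1")
      case True
      \<comment> \<open>At \<open>z = 1\<close> the sum counts offsets. None remain only if
        \<open>n = r + 1\<close>, but then \<open>gcd n (r + 1) = n > 1\<close>.\<close>
      then have "card ({r<..<2 * n - r} - {n}) = 0"
        using 0 by (simp del: card_0_eq card_Diff_insert)
      then have "{r<..<2 * n - r} \<subseteq> {n}" by auto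
      moreover have "r + 1 \<in> {r<..<2 * n - r}" using assms by auto
      ultimately have "n = r + 1" by auto
      then show False using R assms by simp
    next
      case False
      have less: "multiplicity 2 b < multiplicity 2 a" if "z ^ a = 1" "z ^ b = -1" "a > 0" for a b
        using multiplicity_2_less_of_powers that by blast
      have eq: "multiplicity 2 a = multiplicity 2 b" if "z ^ a = -1" "z ^ b = -1" "a > 0" "b > 0" for a b
      proof -
        \<comment> \<open>Doubling an exponent raises its valuation by one, so the two strict
          inequalities become \<open>\<le>\<close> in both directions.\<close>
        have "z ^ (2 * a) = 1" "z ^ (2 * b) = 1"
          using that by (auto simp: mult.commute[of 2] power_mult)
        then have "multiplicity 2 b < multiplicity 2 (2 * a)" "multiplicity 2 a < multiplicity 2 (2 * b)"
          using that by (auto intro!: less)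
        then show ?thesis
          using that by (simp add: multiplicity_times_same)
      qed
      consider "z ^ n = 1" "z ^ (r + 1) = 1" | "z ^ n = 1" "z ^ r = -1"
        | "z ^ n = -1" "z ^ (r + 1) = -1" | "z ^ n = -1" "z ^ r = 1"
        using offset_sum_eq_0_iff[OF assms(2) False z] 0 by blast
      then show False
      proof cases
        case 1
        then have "z ^ gcd n (r + 1) = 1" by (rule power_gcd_eq_1)
        then show False using R False by simp
      next
        case 2
        then show False using less[of n r] R assms by simp
      next
        case 3
        then have "multiplicity 2 (r + 1) = multiplicity 2 r"
          using eq[of n "r + 1"] R assms by simp
        \<comment> \<open>Of two consecutive numbers exactly one is odd, so their valuations
          differ.\<close>
        moreover have "multiplicity 2 r = 0 \<longleftrightarrow> odd r" "multiplicity 2 (r + 1) = 0 \<longleftrightarrow> odd (r + 1)"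
          using assms by (intro multiplicity_eq_zero_iff; simp)+
        ultimately show False by auto
      next
        case 4
        then show False using less[of r n] R assms by simp
      qed
    qed
  qed
qed

text \<open>With equal valuations the odd parts have an even difference, so \<open>n - r\<close>
  gains a factor 2. Conversely, \<open>n\<close> and \<open>r\<close> agree modulo
  \<open>2 ^ Suc (multiplicity 2 n)\<close>, which carries the exact power of 2 from
  \<open>n\<close> over to \<open>r\<close>.\<close>

lemma multiplicity_2_eq_iff:
  fixes n r :: nat
  assumes "1 \<le> r" "r < n"
  shows "multiplicity 2 n = multiplicity 2 r \<longleftrightarrow>
    (even n \<longleftrightarrow> even r) \<and> multiplicity 2 n < multiplicity 2 (n - r)"
proof
  assume eq: "multiplicity 2 n = multiplicity 2 r"
  obtain a where a: "n = 2 ^ multiplicity 2 n * a" "odd a"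
    using multiplicity_decompose'[of n 2] assms by auto
  obtain b where b: "r = 2 ^ multiplicity 2 n * b" "odd b"
    using multiplicity_decompose'[of r 2] assms unfolding eq by auto
  have "n - r = 2 ^ multiplicity 2 n * (a - b)"
    using a(1) b(1) by (metis diff_mult_distrib2)
  moreover have "2 dvd a - b" using a b by simp
  ultimately have "2 ^ Suc (multiplicity 2 n) dvd n - r"
    by (metis mult_dvd_mono dvd_refl power_Suc2)
  then have "Suc (multiplicity 2 n) \<le> multiplicity 2 (n - r)"
    using assms by (intro multiplicity_geI) auto
  moreover have "even n \<longleftrightarrow> even r"
    using a b by (metis even_mult_iff)
  ultimately show "(even n \<longleftrightarrow> even r) \<and> multiplicity 2 n < multiplicity 2 (n - r)" by simp
next
  assume "(even n \<longleftrightarrow> even r) \<and> multiplicity 2 n < multiplicity 2 (n - r)"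
  then have *: "2 ^ Suc (multiplicity 2 n) dvd n - r"
    by (intro multiplicity_dvd') auto
  have n: "2 ^ multiplicity 2 n dvd n" "\<not> 2 ^ Suc (multiplicity 2 n) dvd n"
    using assms by (auto simp: multiplicity_dvd power_dvd_iff_le_multiplicity simp del: power_Suc)
  have "2 ^ multiplicity 2 n dvd n - r"
    using * by (rule power_le_dvd) simp
  then have "2 ^ multiplicity 2 n dvd r"
    using dvd_diffD1 n(1) less_imp_le[OF assms(2)] by blast
  moreover have "\<not> 2 ^ Suc (multiplicity 2 n) dvd r"
    using n(2) dvd_diffD[OF *] less_imp_le[OF assms(2)] by blast
  ultimately show "multiplicity 2 n = multiplicity 2 r"
    by (intro multiplicity_eqI[symmetric])
qed

theorem lemma22:
  fixes n r :: nat
  assumes "1 \<le> r" and "r < n"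
  shows "nonsingular_graph (complement_graph (C2n n r)) \<longleftrightarrow>
           (even n \<longleftrightarrow> even r) \<and>
           gcd n (r + 1) = 1 \<and>
           (2::nat) ^ multiplicity 2 n < 2 ^ multiplicity 2 (n - r)"
proof -
  let ?A = "adj_mat (complement_graph (C2n n r))" and ?S = "{r<..<2 * n - r} - {n}"
  have A: "?A \<in> carrier_mat (2 * n) (2 * n)"
    by (simp add: adj_mat_def complement_graph_def C2n_def)
  have sum: "(\<Sum>d<2 * n. of_real (of_bool (d \<in> ?S)) * z ^ d) = (\<Sum>d\<in>?S. z ^ d)"
    for z :: complex
    by (intro sum.mono_neutral_cong_right) auto
  have "invertible_mat ?A \<longleftrightarrow>
      (\<forall>z::complex. z ^ (2 * n) = 1 \<longrightarrow> (\<Sum>d<2 * n. of_real (of_bool (d \<in> ?S)) * z ^ d) \<noteq> 0)"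
    using assms(2)
    by (intro invertible_circulant_iff[OF A] adj_mat_complement_C2n) auto
  \<comment> \<open>The theorem compares powers of 2, which amounts to comparing their
    exponents.\<close>
  then show ?thesis
    unfolding nonsingular_graph_def sum offset_sum_nonzero_iff[OF assms] multiplicity_2_eq_iff[OF assms]
    by auto
qed

end
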